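(* Let $(X,M,f,\alpha,\star)$ be an $\mathscr{F}$-complete fuzzy $\mathscr{F}$-metric space and let $T:X\to X$ be a fuzzy $\psi$-contraction mapping with respect to some function $\psi\in\Psi$, such that there exists $y\in X$ satisfying $0<M(y,Ty,t)<1$ for all $t>0$. Then $T$ has at most one fixed point in $X$.
   Context: A continuous $t$-norm is a continuous map $\star:[0,1]\times[0,1]\to[0,1]$ that is associative, commutative, satisfies $a\star 1=a$ for all $a$, and $a\star c\le b\star d$ whenever $a\le b$ and $c\le d$. $\mathscr{F}$ is the set of functions $f:[0,1]\to[0,1]$ such that (1) $f$ is strictly increasing on $[0,1)$; (2) for every sequence $(t_n)$ in $[0,1]$, $\lim_n t_n=1$ if and only if $\lim_n f(t_n)=1$. A fuzzy $\mathscr{F}$-metric space $(X,M,f,\alpha,\star)$ consists of a nonempty set $X$, a continuous $t$-norm $\star$, a pair $(f,\alpha)\in\mathscr{F}\times(0,1]$ and a map $M:X\times X\times(0,\infty)\to[0,1]$ such that for all $x,y\in X$ and $t>0$: (i) $M(x,y,t)>0$; (ii) $M(x,y,s)=1$ for all $s>0$ if and only if $x=y$; (iii) $M(x,y,t)=M(y,x,t)$; (iv) for every integer $N\ge 2$, all $u_1,\dots,u_N\in X$ with $u_1=x$, $u_N=y$, and all $t_1,\dots,t_{N-1}>0$ with $t=t_1+\cdots+t_{N-1}$, if $M(x,y,t)<1$ then $(f(M(x,y,t)))^{\alpha}\ge f\big(M(u_1,u_2,t_1)\star\cdots\star M(u_{N-1},u_N,t_{N-1})\big)$. A sequence $(x_n)$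 in $X$ is $\mathscr{F}$-convergent to $x\in X$ if $\lim_{n\to\infty}M(x_n,x,t)=1$ for all $t>0$, and is $\mathscr{F}$-Cauchy if $\lim_{m,n\to\infty}M(x_n,x_m,t)=1$ for all $t>0$. The space is $\mathscr{F}$-complete if every $\mathscr{F}$-Cauchy sequence in $X$ is $\mathscr{F}$-convergent to a point of $X$. $\Psi$ is the class of maps $\psi:[0,1]\to[0,1]$ that are continuous and nondecreasing and satisfy $\psi(t)>t$ for all $t\in(0,1)$. A mapping $T:X\to X$ is a fuzzy $\psi$-contraction mapping with respect to $\psi\in\Psi$ if for all $x,y\in X$ and $t>0$: $0<M(x,y,t)<1$ implies $M(Tx,Ty,t)\ge\psi(M(x,y,t))$. *)

theory Defs
  imports "HOL-Analysis.Analysis"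
begin

definition continuous_t_norm :: "(real \<Rightarrow> real \<Rightarrow> real) \<Rightarrow> bool" where
  "continuous_t_norm star \<longleftrightarrow>
     (\<forall>a\<in>{0..1}. \<forall>b\<in>{0..1}. star a b \<in> {0..1}) \<and>
     continuous_on ({0..1} \<times> {0..1}) (\<lambda>(a, b). star a b) \<and>
     (\<forall>a\<in>{0..1}. \<forall>b\<in>{0..1}. \<forall>c\<in>{0..1}. star (star a b) c = star a (star b c)) \<and>
     (\<forall>a\<in>{0..1}. \<forall>b\<in>{0..1}. star a b = star b a) \<and>
     (\<forall>a\<in>{0..1}. star a 1 = a) \<and>
     (\<forall>a\<in>{0..1}. \<forall>b\<in>{0..1}. \<forall>c\<in>{0..1}. \<forall>d\<in>{0..1}.
        a \<le> b \<longrightarrow> c \<le> d \<longrightarrow> star a c \<le> star b d)"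

text \<open>The value is \<open>a 1 \<star> a 2 \<star> \<dots> \<star> a n\<close>, for \<open>n \<ge> 1\<close>.\<close>
definition t_norm_prod :: "(real \<Rightarrow> real \<Rightarrow> real) \<Rightarrow> (nat \<Rightarrow> real) \<Rightarrow> nat \<Rightarrow> real" where
  "t_norm_prod star a n = foldl star (a 1) (map a [2..<Suc n])"

definition class_F :: "(real \<Rightarrow> real) set" where
  "class_F = {f. f \<in> {0..1} \<rightarrow> {0..1} \<and>
     strict_mono_on {0..<1} f \<and>
     (\<forall>t :: nat \<Rightarrow> real. range t \<subseteq> {0..1} \<longrightarrow>
        (t \<longlonglongrightarrow> 1 \<longleftrightarrow> (\<lambda>n. f (t n)) \<longlonglongrightarrow> 1))}"

text \<open>Only the values of \<open>M\<close> on \<open>X \<times> X \<times> (0, \<infinity>)\<close>, of \<open>f\<close> on \<open>[0, 1]\<close> and of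
  \<open>star\<close> on \<open>[0, 1] \<times> [0, 1]\<close> are relevant. Since \<open>\<alpha> > 0\<close>, the library convention
  \<open>0 powr \<alpha> = 0\<close> agrees with the usual power.\<close>
definition fuzzy_F_metric_space ::
    "'a set \<Rightarrow> ('a \<Rightarrow> 'a \<Rightarrow> real \<Rightarrow> real) \<Rightarrow> (real \<Rightarrow> real) \<Rightarrow> real
      \<Rightarrow> (real \<Rightarrow> real \<Rightarrow> real) \<Rightarrow> bool" where
  "fuzzy_F_metric_space X M f \<alpha> star \<longleftrightarrow>
     X \<noteq> {} \<and> continuous_t_norm star \<and> f \<in> class_F \<and> \<alpha> \<in> {0<..1} \<and>
     (\<forall>x\<in>X. \<forall>y\<in>X. \<forall>t>0. M x y t \<in> {0..1}) \<and>
     (\<forall>x\<in>X. \<forall>y\<in>X. \<forall>t>0. M x y t > 0) \<and>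
     (\<forall>x\<in>X. \<forall>y\<in>X. (\<forall>s>0. M x y s = 1) \<longleftrightarrow> x = y) \<and>
     (\<forall>x\<in>X. \<forall>y\<in>X. \<forall>t>0. M x y t = M y x t) \<and>
     (\<forall>x\<in>X. \<forall>y\<in>X. \<forall>t>0. \<forall>N\<ge>2. \<forall>(u :: nat \<Rightarrow> 'a) (s :: nat \<Rightarrow> real).
        (\<forall>i\<in>{1..N}. u i \<in> X) \<longrightarrow> u 1 = x \<longrightarrow> u N = y \<longrightarrow>
        (\<forall>i\<in>{1..N-1}. s i > 0) \<longrightarrow> t = (\<Sum>i=1..N-1. s i) \<longrightarrow>
        M x y t < 1 \<longrightarrow>
        f (M x y t) powr \<alpha> \<ge> f (t_norm_prod star (\<lambda>i. M (u i) (u (Suc i)) (s i)) (N - 1)))"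

definition F_convergent_to ::
    "('a \<Rightarrow> 'a \<Rightarrow> real \<Rightarrow> real) \<Rightarrow> (nat \<Rightarrow> 'a) \<Rightarrow> 'a \<Rightarrow> bool" where
  "F_convergent_to M x l \<longleftrightarrow> (\<forall>t>0. (\<lambda>n. M (x n) l t) \<longlonglongrightarrow> 1)"

definition F_Cauchy :: "('a \<Rightarrow> 'a \<Rightarrow> real \<Rightarrow> real) \<Rightarrow> (nat \<Rightarrow> 'a) \<Rightarrow> bool" where
  "F_Cauchy M x \<longleftrightarrow>
     (\<forall>t>0. ((\<lambda>(m, n). M (x n) (x m) t) \<longlongrightarrow> 1) (sequentially \<times>\<^sub>F sequentially))"

definition F_complete :: "'a set \<Rightarrow> ('a \<Rightarrow> 'a \<Rightarrow> real \<Rightarrow> real) \<Rightarrow> bool" where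
  "F_complete X M \<longleftrightarrow>
     (\<forall>x. range x \<subseteq> X \<longrightarrow> F_Cauchy M x \<longrightarrow> (\<exists>l\<in>X. F_convergent_to M x l))"

definition class_Psi :: "(real \<Rightarrow> real) set" where
  "class_Psi = {\<psi>. \<psi> \<in> {0..1} \<rightarrow> {0..1} \<and> continuous_on {0..1} \<psi> \<and>
     mono_on {0..1} \<psi> \<and> (\<forall>t\<in>{0<..<1}. \<psi> t > t)}"

definition fuzzy_psi_contraction ::
    "'a set \<Rightarrow> ('a \<Rightarrow> 'a \<Rightarrow> real \<Rightarrow> real) \<Rightarrow> (real \<Rightarrow> real) \<Rightarrow> ('a \<Rightarrow> 'a) \<Rightarrow> bool" where
  "fuzzy_psi_contraction X M \<psi> T \<longleftrightarrow> T \<in> X \<rightarrow> X \<and>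
     (\<forall>x\<in>X. \<forall>y\<in>X. \<forall>t>0. 0 < M x y t \<and> M x y t < 1 \<longrightarrow> M (T x) (T y) t \<ge> \<psi> (M x y t))"

end

theory Submission
  imports Defs
begin

text \<open>Two distinct fixed points \<open>x\<close> and \<open>y\<close> would satisfy \<open>M x y s < 1\<close> at some scale
  \<open>s\<close>, because \<open>M\<close> separates points. Since \<open>\<psi>\<close> lies strictly above the identity on the
  open unit interval, the contraction condition makes \<open>M (T x) (T y) s\<close> strictly larger than
  \<open>M x y s\<close>; but the two values agree, as \<open>T\<close> fixes both points.\<close>

theorem theorem4p2:
  fixes X :: "'a set" and M :: "'a \<Rightarrow> 'a \<Rightarrow> real \<Rightarrow> real"
    and f :: "real \<Rightarrow> real" and \<alpha> :: real and star :: "real \<Rightarrow> real \<Rightarrow> real"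
    and T :: "'a \<Rightarrow> 'a"
  assumes "fuzzy_F_metric_space X M f \<alpha> star"
    and "F_complete X M"
    and "\<exists>\<psi>\<in>class_Psi. fuzzy_psi_contraction X M \<psi> T"
    and "\<exists>y\<in>X. \<forall>t>0. 0 < M y (T y) t \<and> M y (T y) t < 1"
  shows "\<exists>\<^sub>\<le>\<^sub>1 x. x \<in> X \<and> T x = x"
proof (rule Uniq_I, rule ccontr)
  fix x y
  assume "x \<in> X \<and> T x = x" and "y \<in> X \<and> T y = y" and "y \<noteq> x"
  then have x: "x \<in> X" "T x = x" and y: "y \<in> X" "T y = y"
    by auto
  obtain \<psi> where psi: "\<psi> \<in> class_Psi" "fuzzy_psi_contraction X M \<psi> T"
    using assms(3) by blast
  have range: "\<And>a b t. a \<in> X \<Longrightarrow> b \<in> X \<Longrightarrow> t > 0 \<Longrightarrow> M a b t \<in> {0..1}"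
    and positive: "\<And>a b t. a \<in> X \<Longrightarrow> b \<in> X \<Longrightarrow> t > 0 \<Longrightarrow> M a b t > 0"
    and separated: "\<And>a b. a \<in> X \<Longrightarrow> b \<in> X \<Longrightarrow> (\<forall>s>0. M a b s = 1) \<longleftrightarrow> a = b"
    using assms(1) unfolding fuzzy_F_metric_space_def by - (elim conjE, simp)+
  obtain s where s: "s > 0" "M x y s \<noteq> 1"
    using separated[OF x(1) y(1)] \<open>y \<noteq> x\<close> by blast
  have inside: "0 < M x y s" "M x y s < 1"
    using range[OF x(1) y(1) s(1)] positive[OF x(1) y(1) s(1)] s(2) by auto
  have "M x y s < \<psi> (M x y s)"
    using psi(1) inside by (auto simp: class_Psi_def)
  also have "\<dots> \<le> M (T x) (T y) s"
    using psi(2) x(1) y(1) s(1) inside unfolding fuzzy_psi_contraction_def by blast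
  finally show False
    using x(2) y(2) by simp
qed

end
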